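(* Let $U$ be a finite nonempty set and let $\mathbf{C}$ be a covering of $U$. Then $Cov(\mathbf{C})=Cov(reduct(\mathbf{C}))$.
   Context: A covering of $U$ is a family $\mathbf{C}$ of subsets of $U$ with $\emptyset\notin\mathbf{C}$ and $\bigcup\mathbf{C}=U$; its elements are called blocks. An element $K\in\mathbf{C}$ is a reducible element of $\mathbf{C}$ if $K$ is a union of some blocks in $\mathbf{C}-\{K\}$; otherwise it is irreducible. The reduct of $\mathbf{C}$, denoted $reduct(\mathbf{C})$, is the subfamily $D\subseteq\mathbf{C}$ such that $\mathbf{C}-D$ is the set of all reducible elements of $\mathbf{C}$ (i.e. the set of irreducible elements of $\mathbf{C}$); it is known to be again a covering of $U$. For any covering $\mathbf{D}$ of $U$ and $x\in U$, the neighborhood of $x$ induced by $\mathbf{D}$ is $N_{\mathbf{D}}(x)=\bigcap\{K\in\mathbf{D}\mid x\in K\}$, and $Cov(\mathbf{D})=\{N_{\mathbf{D}}(x)\mid x\in U\}$. *)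

theory Defs
  imports Main
begin

definition covering :: "'a set \<Rightarrow> 'a set set \<Rightarrow> bool" where
  "covering U C \<longleftrightarrow> C \<subseteq> Pow U \<and> {} \<notin> C \<and> \<Union>C = U"

text \<open>The union may be taken over any subfamily, including the empty one; the latter
  only yields the empty set, which is never a block of a covering.\<close>

definition reducible_element :: "'a set set \<Rightarrow> 'a set \<Rightarrow> bool" where
  "reducible_element C K \<longleftrightarrow> K \<in> C \<and> (\<exists>B. B \<subseteq> C - {K} \<and> K = \<Union>B)"

definition reduct :: "'a set set \<Rightarrow> 'a set set" where
  "reduct C = C - {K. reducible_element C K}"

definition neighborhood :: "'a set set \<Rightarrow> 'a \<Rightarrow> 'a set" where
  "neighborhood D x = \<Inter>{K \<in> D. x \<in> K}"

text \<open>A covering determines its universe as the union of its blocks, but the universe is kept as an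
  explicit argument so that the same \<open>U\<close> is used for a covering and for its reduct.\<close>

definition Cov :: "'a set \<Rightarrow> 'a set set \<Rightarrow> 'a set set" where
  "Cov U D = {neighborhood D x | x. x \<in> U}"

end

theory Submission
  imports Defs
begin

text \<open>Inside any block containing \<open>x\<close>, a minimal block containing \<open>x\<close> is irreducible, since a
  reducible block is a union of strictly smaller ones. Hence discarding the reducible blocks leaves
  every neighborhood unchanged.\<close>

lemma irreducible_block_below:
  assumes "finite K" "K \<in> C" "x \<in> K"
  shows "\<exists>L \<in> reduct C. x \<in> L \<and> L \<subseteq> K"
  using assms
\<comment> \<open>No minimal block is chosen explicitly: the induction descends from a reducible
  block to a strictly smaller one that still contains \<open>x\<close>.\<close>
proof (induction K rule: finite_psubset_induct)
  case (psubset K)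
  show ?case
  proof (cases "reducible_element C K")
    case True
    then obtain B where B: "B \<subseteq> C - {K}" "K = \<Union>B"
      unfolding reducible_element_def by (elim conjE exE)
    with \<open>x \<in> K\<close> obtain M where "M \<in> B" "x \<in> M" by auto
    \<comment> \<open>As \<open>B\<close> avoids \<open>K\<close>, the member \<open>M\<close>
      around \<open>x\<close> is a proper subset of \<open>K\<close>, so the induction hypothesis
      applies to it.\<close>
    from B(1) \<open>M \<in> B\<close> have "M \<in> C" "M \<noteq> K" by auto
    moreover have "M \<subseteq> K" unfolding B(2) using \<open>M \<in> B\<close> by (rule Union_upper)
    ultimately obtain L where "L \<in> reduct C" "x \<in> L" "L \<subseteq> M"
      using psubset.IH[of M] \<open>x \<in> M\<close> by auto
    with \<open>M \<subseteq> K\<close> show ?thesis by (meson order_trans)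
  next
    case False
    with psubset.prems show ?thesis unfolding reduct_def by auto
  qed
qed

text \<open>Intersecting fewer blocks can only enlarge the neighborhood. Conversely, each block
  around \<open>x\<close> contains an irreducible one around \<open>x\<close>, so the discarded
  blocks impose no further constraint.\<close>

lemma neighborhood_reduct:
  assumes "\<And>K. K \<in> C \<Longrightarrow> finite K"
  shows "neighborhood (reduct C) x = neighborhood C x"
proof
  show "neighborhood C x \<subseteq> neighborhood (reduct C) x"
    unfolding neighborhood_def reduct_def by blast
  show "neighborhood (reduct C) x \<subseteq> neighborhood C x"
  proof
    fix y assume y: "y \<in> neighborhood (reduct C) x"
    have "y \<in> K" if K: "K \<in> C" "x \<in> K" for K
    proof -
      obtain L where "L \<in> reduct C" "x \<in> L" "L \<subseteq> K"
        using irreducible_block_below[OF assms[OF K(1)] K] by blast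
      with y show ?thesis unfolding neighborhood_def by blast
    qed
    then show "y \<in> neighborhood C x" unfolding neighborhood_def by blast
  qed
qed

theorem proposition14:
  fixes U :: "'a set" and C :: "'a set set"
  assumes "finite U" and "U \<noteq> {}" and "covering U C"
  shows "Cov U C = Cov U (reduct C)"
proof -
  have "finite K" if "K \<in> C" for K
  proof -
    from assms(3) that have "K \<subseteq> U" unfolding covering_def by blast
    then show ?thesis using assms(1) by (rule finite_subset)
  qed
  then show ?thesis
    unfolding Cov_def by (simp add: neighborhood_reduct)
qed

end
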